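(* Let $G$ be a connected graph and let $x$ be a vertex of $G$ that is not a cut vertex and that belongs to some dual general position set of $G$ of cardinality $\mathrm{gp}_{\rm d}(G)$. Then $\mathrm{gp}_{\rm d}(G)-1\le \mathrm{gp}_{\rm d}(G-x)$. Moreover, this bound is sharp, i.e., equality holds for some such $G$ and $x$.
   Context: All graphs are finite, simple and connected. For a graph $G$ and $Z\subseteq V(G)$, two vertices $p,q\in V(G)$ are $Z$-positionable if no shortest $p,q$-path in $G$ has an internal vertex in $Z$. $Z$ is a dual general position set if every two vertices of $Z$ are $Z$-positionable and every two vertices of $V(G)\setminus Z$ are $Z$-positionable. $\mathrm{gp}_{\rm d}(G)$ is the maximum cardinality of a dual general position set of $G$. $G-x$ is the graph obtained by deleting $x$ and its incident edges. *)

theory Defs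
  imports "Graph_Theory.Graph_Theory"
begin

(* A finite simple undirected graph is a digraph satisfying the library locale "graph"
   (finite, loop-free, no parallel arcs, symmetric): each edge is a pair of opposite arcs. *)

definition shortest_path :: "('a, 'b) pre_digraph \<Rightarrow> 'a \<Rightarrow> 'b list \<Rightarrow> 'a \<Rightarrow> bool" where
  "shortest_path G u p v \<longleftrightarrow> pre_digraph.apath G u p v \<and>
     (\<forall>q. pre_digraph.apath G u q v \<longrightarrow> length p \<le> length q)"

(* A p,q-path has its end vertices p and q fixed, so its internal vertices are the members of
   inner_verts, the vertex sequence without its first and last entry. *)
definition positionable :: "('a, 'b) pre_digraph \<Rightarrow> 'a set \<Rightarrow> 'a \<Rightarrow> 'a \<Rightarrow> bool" where
  "positionable G Z u v \<longleftrightarrow>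
     \<not> (\<exists>p. shortest_path G u p v \<and> set (pre_digraph.inner_verts G p) \<inter> Z \<noteq> {})"

definition dual_gp_set :: "('a, 'b) pre_digraph \<Rightarrow> 'a set \<Rightarrow> bool" where
  "dual_gp_set G Z \<longleftrightarrow> Z \<subseteq> verts G \<and>
     (\<forall>u \<in> Z. \<forall>v \<in> Z. u \<noteq> v \<longrightarrow> positionable G Z u v) \<and>
     (\<forall>u \<in> verts G - Z. \<forall>v \<in> verts G - Z. u \<noteq> v \<longrightarrow> positionable G Z u v)"

(* The set is nonempty for every G, as the empty set is a dual general position set,
   and it is finite when G is. *)
definition gp_d :: "('a, 'b) pre_digraph \<Rightarrow> nat" where
  "gp_d G = Max {card Z | Z. dual_gp_set G Z}"

(* The connected components of a symmetric digraph are its strongly connected components. *)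
definition cut_vertex :: "('a, 'b) pre_digraph \<Rightarrow> 'a \<Rightarrow> bool" where
  "cut_vertex G x \<longleftrightarrow> x \<in> verts G \<and>
     card (pre_digraph.sccs G) < card (pre_digraph.sccs (pre_digraph.del_vert G x))"

end

theory Submission
  imports Defs
begin

text \<open>
  Deleting \<open>x\<close> from a dual general position set \<open>Z\<close> containing it gives a dual general
  position set of \<open>G - x\<close>: two vertices other than \<open>x\<close> that are both in \<open>Z\<close> or both outside \<open>Z\<close>
  are positionable, so no shortest path of \<open>G\<close> between them meets \<open>x\<close>, and hence the shortest
  paths of \<open>G - x\<close> between them are shortest paths of \<open>G\<close>. The bound is attained by the
  complete graph on two vertices.
\<close>

context wf_digraph
begin

text \<open>Deletion shrinks only \<open>verts\<close> and \<open>arcs\<close>; vertex sequences and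
  \<open>cas\<close> are computed from \<open>tail\<close> and \<open>head\<close>, which stay the
  same.\<close>

lemma awalk_verts_del_vert [simp]: "pre_digraph.awalk_verts (del_vert x) u p = awalk_verts u p"
  by (simp add: pre_digraph.awalk_verts_conv del_vert_simps)

lemma inner_verts_del_vert [simp]: "pre_digraph.inner_verts (del_vert x) p = inner_verts p"
  by (simp add: pre_digraph.inner_verts_def del_vert_simps)

lemma cas_del_vert [simp]: "pre_digraph.cas (del_vert x) u p v = cas u p v"
  by (induction p arbitrary: u) (simp_all add: pre_digraph.cas.simps del_vert_simps)

lemma apath_if_apath_del_vert:
  assumes "pre_digraph.apath (del_vert x) u p v"
  shows "apath u p v"
  using assms by (auto simp: pre_digraph.apath_def pre_digraph.awalk_def del_vert_simps)

lemma apath_del_vertI: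
  assumes "apath u p v" and "x \<notin> set (awalk_verts u p)"
  shows "pre_digraph.apath (del_vert x) u p v"
proof -
  have p: "u \<in> verts G" "set p \<subseteq> arcs G" "cas u p v" "distinct (awalk_verts u p)"
    using assms(1) by (auto simp: apath_def awalk_def)
  have "u \<noteq> x"
    using assms hd_in_awalk_verts(2) by blast
  \<comment> \<open>The vertex sequence lists all tails followed by the last head, and equally the
    first tail followed by all heads. Hence avoiding \<open>x\<close> means using no deleted
    arc.\<close>
  moreover have "tail G e \<noteq> x \<and> head G e \<noteq> x" if "e \<in> set p" for e
    using that assms(2) awalk_verts_conv[of u p] awalk_verts_conv'[OF p(3)]
    by (metis (no_types, lifting) Un_iff image_eqI empty_iff list.set(1) set_append set_map set_subset_Cons subsetD)
  ultimately show ?thesis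
    using p by (auto simp: pre_digraph.apath_def pre_digraph.awalk_def del_vert_simps)
qed

lemma shortest_path_exists:
  assumes "apath u p v"
  obtains q where "shortest_path G u q v"
proof -
  obtain q where "apath u q v" "\<forall>r. length r < length q \<longrightarrow> \<not> apath u r v"
    using exists_least_iff[of "\<lambda>n. \<exists>r. length r = n \<and> apath u r v"] assms by metis
  then show ?thesis
    using that by (force simp: shortest_path_def)
qed

lemma shortest_path_if_shortest_path_del_vert:
  assumes p: "shortest_path (del_vert x) u p v"
    and pos: "positionable G Z u v" and x: "x \<in> Z" "u \<noteq> x" "v \<noteq> x"
  shows "shortest_path G u p v"
proof -
  have ap: "apath u p v"
    using p apath_if_apath_del_vert by (auto simp: shortest_path_def)
  \<comment> \<open>A shortest path \<open>q\<close> of \<open>G\<close> serves as a yardstick: it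
    avoids \<open>x\<close>, so it survives the deletion and cannot be shorter than
    \<open>p\<close>.\<close>
  obtain q where q: "shortest_path G u q v"
    using shortest_path_exists[OF ap] .
  have "x \<notin> set (inner_verts q)"
    using pos q x(1) by (auto simp: positionable_def)
  moreover have qa: "apath u q v"
    using q by (simp add: shortest_path_def)
  ultimately have "x \<notin> set (awalk_verts u q)"
    using set_inner_verts[OF qa] x by auto
  then have "length p \<le> length q"
    using p apath_del_vertI[OF qa] by (auto simp: shortest_path_def)
  then show ?thesis
    using ap q by (auto simp: shortest_path_def)
qed

lemma positionable_del_vert:
  assumes "positionable G Z u v" "x \<in> Z" "u \<noteq> x" "v \<noteq> x"
  shows "positionable (del_vert x) (Z - {x}) u v"
  using assms shortest_path_if_shortest_path_del_vert[OF _ assms]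
  unfolding positionable_def by auto

text \<open>Since \<open>x\<close> lies in \<open>Z\<close>, the complement of
  \<open>Z - {x}\<close> in the smaller graph is exactly the complement of \<open>Z\<close> in
  \<open>G\<close>, so no new pairs have to be checked.\<close>

lemma dual_gp_set_del_vert:
  assumes "dual_gp_set G Z" "x \<in> Z"
  shows "dual_gp_set (del_vert x) (Z - {x})"
  using assms unfolding dual_gp_set_def del_vert_simps
  by (auto intro!: positionable_del_vert)

end

context fin_digraph
begin

lemma finite_card_dual_gp_sets: "finite {card Z | Z. dual_gp_set G Z}"
  by (rule finite_subset[of _ "card ` Pow (verts G)"]) (auto simp: dual_gp_set_def)

lemma card_le_gp_d:
  assumes "dual_gp_set G Z"
  shows "card Z \<le> gp_d G"
  unfolding gp_d_def using assms by (intro Max_ge finite_card_dual_gp_sets) auto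

text \<open>Two distinct ends already exhaust the vertices, which leaves none to be
  internal.\<close>

lemma dual_gp_set_verts_small:
  assumes "card (verts G) \<le> 2"
  shows "dual_gp_set G (verts G)"
proof -
  have "set (inner_verts p) = {}"
    if "u \<noteq> v" "shortest_path G u p v" for u v p
  proof -
    have p: "apath u p v"
      using that by (simp add: shortest_path_def)
    then have uv: "set (awalk_verts u p) \<subseteq> verts G" "{u, v} \<subseteq> verts G"
      by (auto simp: apath_def awalk_last_in_verts awalk_hd_in_verts)
    then have "verts G = {u, v}"
      using card_seteq[of "verts G" "{u, v}"] assms \<open>u \<noteq> v\<close> by simp
    then show ?thesis
      using set_inner_verts[OF p] uv by auto
  qed
  then show ?thesis
    by (auto simp: dual_gp_set_def positionable_def)
qed

lemma gp_d_small:
  assumes "card (verts G) \<le> 2"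
  shows "gp_d G = card (verts G)"
  unfolding gp_d_def
proof (rule Max_eqI[OF finite_card_dual_gp_sets])
  show "card (verts G) \<in> {card Z | Z. dual_gp_set G Z}"
    using dual_gp_set_verts_small[OF assms] by auto
qed (auto simp: dual_gp_set_def intro: card_mono)

text \<open>The set \<open>Z - {x}\<close> has one element fewer than the maximum set
  \<open>Z\<close>. As \<open>Z\<close> is finite and nonempty, the subtraction on naturals does not
  truncate.\<close>

lemma gp_d_del_vert_ge:
  assumes "dual_gp_set G Z" "card Z = gp_d G" "x \<in> Z"
  shows "gp_d G - 1 \<le> gp_d (del_vert x)"
  using fin_digraph.card_le_gp_d[OF fin_digraph_del_vert dual_gp_set_del_vert] assms
  by fastforce

end

definition K2 :: "(nat, nat \<times> nat) pre_digraph" where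
  "K2 = \<lparr>verts = {0, 1}, arcs = {(0, 1), (1, 0)}, tail = fst, head = snd\<rparr>"

lemma graph_K2: "graph K2"
  by unfold_locales
    (auto simp: K2_def arc_to_ends_def symmetric_def sym_def arcs_ends_def)

lemma strongly_connected_K2: "strongly_connected K2"
proof -
  interpret graph K2 by (rule graph_K2)
  have "(0, 1) \<in> arcs_ends K2" "(1, 0) \<in> arcs_ends K2"
    by (auto simp: K2_def arcs_ends_def arc_to_ends_def)
  then have "0 \<rightarrow>\<^sup>*\<^bsub>K2\<^esub> 1" "1 \<rightarrow>\<^sup>*\<^bsub>K2\<^esub> 0"
    by (simp_all only: reachable_adjI)
  moreover have "verts K2 = {0, 1}"
    by (simp add: K2_def)
  ultimately show ?thesis
    by (auto simp: strongly_connected_def)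
qed

lemma verts_K2_del_vert: "verts (pre_digraph.del_vert K2 0) = {1}"
  by (auto simp: K2_def pre_digraph.del_vert_def)

text \<open>Before and after the deletion the graph is strongly connected, so the number of
  components is 1 both times.\<close>

lemma not_cut_vertex_K2: "\<not> cut_vertex K2 0"
proof -
  interpret graph K2 by (rule graph_K2)
  interpret D: wf_digraph "del_vert 0" by (rule wf_digraph_del_vert)
  have "strongly_connected (del_vert 0)"
    by (auto simp: strongly_connected_def verts_K2_del_vert)
  then show ?thesis
    using strongly_connected_K2
    by (simp add: cut_vertex_def strongly_connected_eq_iff D.strongly_connected_eq_iff)
qed

theorem theorem3p8:
  shows "(\<forall>(G :: ('a, 'b) pre_digraph) x.
            graph G \<and> connected G \<and> x \<in> verts G \<and> \<not> cut_vertex G x \<and>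
            (\<exists>Z. dual_gp_set G Z \<and> card Z = gp_d G \<and> x \<in> Z) \<longrightarrow>
            gp_d G - 1 \<le> gp_d (pre_digraph.del_vert G x)) \<and>
         (\<exists>(G :: (nat, nat \<times> nat) pre_digraph) x.
            graph G \<and> connected G \<and> x \<in> verts G \<and> \<not> cut_vertex G x \<and>
            (\<exists>Z. dual_gp_set G Z \<and> card Z = gp_d G \<and> x \<in> Z) \<and>
            verts (pre_digraph.del_vert G x) \<noteq> {} \<and>
            gp_d G - 1 = gp_d (pre_digraph.del_vert G x))"
proof (intro conjI allI impI)
  fix G :: "('a, 'b) pre_digraph" and x
  assume "graph G \<and> connected G \<and> x \<in> verts G \<and> \<not> cut_vertex G x \<and>
    (\<exists>Z. dual_gp_set G Z \<and> card Z = gp_d G \<and> x \<in> Z)"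
  then obtain Z where "graph G" and Z: "dual_gp_set G Z" "card Z = gp_d G" "x \<in> Z"
    by blast
  then interpret graph G by simp
  show "gp_d G - 1 \<le> gp_d (del_vert x)"
    using Z by (rule gp_d_del_vert_ge)
next
  interpret graph K2 by (rule graph_K2)
  interpret D: fin_digraph "del_vert 0" by (rule fin_digraph_del_vert)
  have verts_gp_d: "verts K2 = {0, 1}" "gp_d K2 = 2"
    using gp_d_small by (simp_all add: K2_def)
  \<comment> \<open>\<open>connected\<close> refers to the symmetric closure, to which reachability
    in \<open>K2\<close> carries over.\<close>
  have "connected K2"
    using strongly_connected_K2 reachable_mk_symmetricI
    by (auto simp: connected_def strongly_connected_def)
  moreover have "dual_gp_set K2 {0, 1}"
    using dual_gp_set_verts_small verts_gp_d(1) by simp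
  moreover have "gp_d (del_vert 0) = 1"
    using D.gp_d_small by (simp add: verts_K2_del_vert)
  ultimately show "\<exists>(G :: (nat, nat \<times> nat) pre_digraph) x.
      graph G \<and> connected G \<and> x \<in> verts G \<and> \<not> cut_vertex G x \<and>
      (\<exists>Z. dual_gp_set G Z \<and> card Z = gp_d G \<and> x \<in> Z) \<and>
      verts (pre_digraph.del_vert G x) \<noteq> {} \<and>
      gp_d G - 1 = gp_d (pre_digraph.del_vert G x)"
    \<comment> \<open>The whole vertex set attains \<open>gp_d K2 = 2\<close>, and the remaining
      single vertex gives the value 1.\<close>
    using graph_K2 not_cut_vertex_K2 verts_gp_d
    by (intro exI[of _ K2] exI[of _ 0] conjI exI[of _ "{0, 1}"])
      (simp_all add: verts_K2_del_vert)
qed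

end
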